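(* Let $X(z,w)=(f(z,w),g(z,w))\in\mathcal{VH}^1$ be a vector field on $\mathbb{H}^2$ which has rotor. Then $\mathrm{rot}X(z,w)$ is bidegree full. If $\mathrm{rot}X(z,w)=0$, then $X$ is bidegree full and has the form $$X(z,w)=\sum_{p,q\ge1}\bigl(S_{p-1,q}(z,w),S_{p,q-1}(z,w)\bigr)a_{p,q}+\Bigl(\sum_{p\ge0}z^pa_p,\ \sum_{q\ge0}w^qb_q\Bigr)$$ with $a_{p,q},a_p,b_q\in\mathbb{H}$; and if one defines $$\chi(z,w):=\sum_{p,q\ge1}S_{p,q}(z,w)\frac{a_{p,q}}{p+q}+\sum_{p\ge0}\Bigl(z^{p+1}\frac{a_p}{p+1}+w^{p+1}\frac{b_p}{p+1}\Bigr)+C,$$ where $C\in\mathbb{H}$ is an arbitrary constant, then $$X(z,w)=\bigl(\widetilde{\partial}_z\chi(z,w),\widetilde{\partial}_w\chi(z,w)\bigr).$$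
   Context: $\mathbb{H}$ is the algebra of quaternions; $z,w$ are two non-commuting quaternionic variables. Power series. $\mathcal{H}^1[z,w]$ denotes the functions on $\mathbb{H}^2$ given by absolutely convergent series $\sum_d f_d(z,w)$, where each $f_d$ is a finite sum $\sum_{\alpha}(z,w)^{\alpha}a_{\alpha}$ with $a_\alpha\in\mathbb{H}$ and $\alpha\in\{0,1\}^d$; here for $\alpha=(\alpha_1,\dots,\alpha_d)$ the word $(z,w)^\alpha$ is the ordered product $(z^{\alpha_1}w^{1-\alpha_1})\cdots(z^{\alpha_d}w^{1-\alpha_d})$ (so all coefficients are on the right). Convention (formal uniqueness): two such functions are considered equal if and only if their power series coincide, i.e. the coefficients of all words coincide; in the same way, identities between expressions in $z,w,h$ that are linear in $h$ are identities between series of words in the non-commuting variables $z,w,h$ with right quaternionic coefficients. Partial derivatives. For $h\in\mathbb{H}$, $\widehat{\partial}_z f(z,w)[h]=\lim_{t\to0}\frac1t\,(f(z+th,w)-f(z,w))$ ($t$ real) and similarly $\widehat{\partial}_w$; i.e. $\widehat\partial_z$ replaces, in each monomial, one occurrence of $z$ at a time by $h$ and sums over all occurrences. Moreover $\widetilde{\partial}_zf(z,w):=\widehat{\partial}_zf(z,w)[1]$ and $\widetilde{\partial}_wf(z,w):=\widehat{\partial}_wf(z,w)[1]$. Bidegree full. $S_{p,q}(z,w)=\sum_{\alpha\in\{0,1\}^{p+q},\,|\alpha|=p}(z,w)^\alpha$, where $|\alpha|=\sum_l\alpha_l$, is the sum of all words with $p$ letters $z$ and $q$ letters $w$. A function is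 bidegree full (BF) if it is a convergent series $\sum_{d\ge0}\sum_{p+q=d}S_{p,q}(z,w)a_{p,q}$ with $a_{p,q}\in\mathbb{H}$. Vector fields. $\mathcal{VH}^1$ is the set of vector fields $X=(f,g)$ on $\mathbb{H}^2$ with $f,g\in\mathcal{H}^1[z,w]$. $X$ is bidegree full if both $f$ and $g$ are. Put $\mathrm{Rot}X(z,w)[h]=-\widehat{\partial}_zg(z,w)[h]+\widehat{\partial}_wf(z,w)[h]$. $X$ has rotor if there is a function $\mathrm{rot}X(z,w)$ with $\mathrm{Rot}X(z,w)[h]=h\,\mathrm{rot}X(z,w)$ for all $h$. *)

theory Defs
  imports "HOL-Analysis.Analysis" "HOL-Library.Function_Algebras"
begin

section \<open>The algebra of quaternions\<close>

datatype quat = Quat (qre: real) (qi: real) (qj: real) (qk: real)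

lemma quat_eq_iff: "x = y \<longleftrightarrow> qre x = qre y \<and> qi x = qi y \<and> qj x = qj y \<and> qk x = qk y"
  by (cases x; cases y) auto

instantiation quat :: real_vector
begin

definition zero_quat :: quat where "0 = Quat 0 0 0 0"
definition plus_quat :: "quat \<Rightarrow> quat \<Rightarrow> quat"
  where "x + y = Quat (qre x + qre y) (qi x + qi y) (qj x + qj y) (qk x + qk y)"
definition uminus_quat :: "quat \<Rightarrow> quat"
  where "- x = Quat (- qre x) (- qi x) (- qj x) (- qk x)"
definition minus_quat :: "quat \<Rightarrow> quat \<Rightarrow> quat"
  where "x - y = Quat (qre x - qre y) (qi x - qi y) (qj x - qj y) (qk x - qk y)"
definition scaleR_quat :: "real \<Rightarrow> quat \<Rightarrow> quat"
  where "c *\<^sub>R x = Quat (c * qre x) (c * qi x) (c * qj x) (c * qk x)"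

instance
  by standard
    (auto simp: zero_quat_def plus_quat_def uminus_quat_def minus_quat_def scaleR_quat_def
      algebra_simps)

end

instantiation quat :: real_normed_div_algebra
begin

definition one_quat :: quat where "1 = Quat 1 0 0 0"
definition times_quat :: "quat \<Rightarrow> quat \<Rightarrow> quat"
  where "x * y = Quat
    (qre x * qre y - qi x * qi y - qj x * qj y - qk x * qk y)
    (qre x * qi y + qi x * qre y + qj x * qk y - qk x * qj y)
    (qre x * qj y - qi x * qk y + qj x * qre y + qk x * qi y)
    (qre x * qk y + qi x * qj y - qj x * qi y + qk x * qre y)"
definition norm_quat :: "quat \<Rightarrow> real"
  where "norm x = sqrt ((qre x)\<^sup>2 + (qi x)\<^sup>2 + (qj x)\<^sup>2 + (qk x)\<^sup>2)"
definition inverse_quat :: "quat \<Rightarrow> quat"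
  where "inverse x = (1 / (norm x)\<^sup>2) *\<^sub>R Quat (qre x) (- qi x) (- qj x) (- qk x)"
definition "x div y = x * inverse y" for x y :: quat
definition "sgn x = x /\<^sub>R norm x" for x :: quat
definition "dist x y = norm (x - y)" for x y :: quat
definition uniformity_quat :: "(quat \<times> quat) filter"
  where "uniformity_quat = (INF e\<in>{0 <..}. principal {(x, y). dist x y < e})"
definition open_quat :: "quat set \<Rightarrow> bool"
  where "open_quat U \<longleftrightarrow> (\<forall>x\<in>U. eventually (\<lambda>(x', y). x' = x \<longrightarrow> y \<in> U) uniformity)"

lemma norm_quat_sq: "(norm x)\<^sup>2 = (qre x)\<^sup>2 + (qi x)\<^sup>2 + (qj x)\<^sup>2 + (qk x)\<^sup>2" for x :: quat
  by (simp add: norm_quat_def)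

lemma norm_quat_eq_0: "norm x = 0 \<longleftrightarrow> x = 0" for x :: quat
proof -
  have "norm x = 0 \<longleftrightarrow> (qre x)\<^sup>2 + (qi x)\<^sup>2 + (qj x)\<^sup>2 + (qk x)\<^sup>2 = 0"
    by (simp add: norm_quat_def)
  also have "\<dots> \<longleftrightarrow> x = 0"
    by (simp add: quat_eq_iff zero_quat_def add_nonneg_eq_0_iff)
  finally show ?thesis .
qed

lemma norm_quat_L2: "norm x = L2_set (\<lambda>n. [qre x, qi x, qj x, qk x] ! n) {..<4}" for x :: quat
  by (simp add: norm_quat_def L2_set_def eval_nat_numeral)

instance
proof
  show "(x * y) * z = x * (y * z)" "(x + y) * z = x * z + y * z" "x * (y + z) = x * y + x * z"
    "1 * x = x" "x * 1 = x"
    and scaleR_l: "a *\<^sub>R x * y = a *\<^sub>R (x * y)"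
    and scaleR_r: "x * a *\<^sub>R y = a *\<^sub>R (x * y)"
    for x y z :: quat and a :: real
    by (simp_all add: quat_eq_iff times_quat_def plus_quat_def one_quat_def scaleR_quat_def
        algebra_simps)
  fix x y z :: quat and a :: real
  show "(0::quat) \<noteq> 1"
    by (simp add: zero_quat_def one_quat_def)
  show "norm x = 0 \<longleftrightarrow> x = 0"
    by (rule norm_quat_eq_0)
  show "norm (x + y) \<le> norm x + norm y"
  proof -
    have "norm (x + y) =
        L2_set (\<lambda>n. [qre x, qi x, qj x, qk x] ! n + [qre y, qi y, qj y, qk y] ! n) {..<4}"
      by (simp add: norm_quat_def L2_set_def plus_quat_def eval_nat_numeral)
    also have "\<dots> \<le> norm x + norm y"
      unfolding norm_quat_L2 by (rule L2_set_triangle_ineq)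
    finally show ?thesis .
  qed
  show "norm (a *\<^sub>R x) = \<bar>a\<bar> * norm x"
  proof -
    have "(a * qre x)\<^sup>2 + (a * qi x)\<^sup>2 + (a * qj x)\<^sup>2 + (a * qk x)\<^sup>2
        = a\<^sup>2 * ((qre x)\<^sup>2 + (qi x)\<^sup>2 + (qj x)\<^sup>2 + (qk x)\<^sup>2)"
      by (simp add: algebra_simps)
    then show ?thesis
      by (simp add: norm_quat_def scaleR_quat_def real_sqrt_mult)
  qed
  show norm_mult: "norm (x * y) = norm x * norm y"
  proof -
    have "(norm (x * y))\<^sup>2 = (norm x * norm y)\<^sup>2"
      unfolding norm_quat_sq power_mult_distrib times_quat_def quat.sel
      by (simp add: power2_eq_square algebra_simps)
    moreover have "0 \<le> norm (x * y)" "0 \<le> norm x * norm y"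
      by (simp_all add: norm_quat_def)
    ultimately show ?thesis
      using power2_eq_imp_eq by blast
  qed
  show "x div y = x * inverse y"
    by (rule divide_quat_def)
  show "inverse (0::quat) = 0"
    by (simp add: inverse_quat_def zero_quat_def scaleR_quat_def)
  have inv: "inverse x * x = 1 \<and> x * inverse x = 1" if "x \<noteq> 0"
  proof -
    define y where "y = Quat (qre x) (- qi x) (- qj x) (- qk x)"
    have "y * x = (norm x)\<^sup>2 *\<^sub>R 1 \<and> x * y = (norm x)\<^sup>2 *\<^sub>R 1"
      unfolding norm_quat_sq y_def
      by (simp add: quat_eq_iff times_quat_def scaleR_quat_def one_quat_def power2_eq_square)
    moreover have "inverse x = (1 / (norm x)\<^sup>2) *\<^sub>R y"
      by (simp add: inverse_quat_def y_def)
    moreover have "norm x \<noteq> 0"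
      using that norm_quat_eq_0 by simp
    ultimately show ?thesis
      by (simp add: scaleR_l scaleR_r)
  qed
  show "x \<noteq> 0 \<Longrightarrow> inverse x * x = 1" "x \<noteq> 0 \<Longrightarrow> x * inverse x = 1"
    using inv by auto
  show "sgn x = x /\<^sub>R norm x" by (rule sgn_quat_def)
  show "dist x y = norm (x - y)" by (rule dist_quat_def)
next
  show "uniformity = (INF e\<in>{0 <..}. principal {(x, y :: quat). dist x y < e})"
    by (rule uniformity_quat_def)
next
  fix U :: "quat set"
  show "open U \<longleftrightarrow> (\<forall>x\<in>U. eventually (\<lambda>(x', y). x' = x \<longrightarrow> y \<in> U) uniformity)"
    by (rule open_quat_def)
qed

end


section \<open>Series of words with right quaternionic coefficients\<close>

text \<open>
  A series over the alphabet \<open>'a\<close> is its coefficient function on words.  Equality of series is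
  therefore equality of the coefficients of all words, also where two different series happen
  to take the same values at all quaternionic points.
\<close>

type_synonym 'a series = "'a list \<Rightarrow> quat"

datatype zw = Z | W

text \<open>Words in \<open>z, w, h\<close>; the letter \<open>H\<close> stands for the increment \<open>h\<close>.\<close>

datatype zwh = Var (the_var: zw) | H

definition rmult :: "'a series \<Rightarrow> quat \<Rightarrow> 'a series"  (infixl "\<odot>" 70) where
  "F \<odot> a = (\<lambda>v. F v * a)"

definition mono_word :: "'a list \<Rightarrow> 'a series" where
  "mono_word u = (\<lambda>v. if v = u then 1 else 0)"

text \<open>
  Sum of a family of series, coefficient by coefficient.  It is only meaningful for families in
  which each word has a nonzero coefficient in finitely many members; all families below are
  of this kind.
\<close>

definition series_sum :: "('i \<Rightarrow> 'a series) \<Rightarrow> 'i set \<Rightarrow> 'a series" where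
  "series_sum F I = (\<lambda>v. \<Sum>i\<in>{i \<in> I. F i v \<noteq> 0}. F i v)"

text \<open>The homogeneous part of degree \<open>d\<close>, evaluated at the point \<open>e\<close>.\<close>

definition hom_part :: "('a \<Rightarrow> quat) \<Rightarrow> 'a series \<Rightarrow> nat \<Rightarrow> quat" where
  "hom_part e F d = (\<Sum>v | length v = d. prod_list (map e v) * F v)"

definition H1 :: "zw series set" where
  "H1 = {f. \<forall>z w. summable (\<lambda>d. norm (hom_part (case_zw z w) f d))}"


section \<open>Partial derivatives\<close>

text \<open>
  \<open>pd_hat x f\<close> is the series in \<open>z, w, h\<close> obtained by replacing, in each monomial of \<open>f\<close>, one
  occurrence of \<open>x\<close> at a time by \<open>h\<close>: a word with exactly one \<open>h\<close> arises in this way only from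
  the word in which that \<open>h\<close> is turned back into \<open>x\<close>.
\<close>

definition pd_hat :: "zw \<Rightarrow> zw series \<Rightarrow> zwh series" where
  "pd_hat x f = (\<lambda>u. if count_list u H = 1 then f (map (case_zwh (\<lambda>y. y) x) u) else 0)"

text \<open>
  Substitution of \<open>1\<close> for \<open>h\<close> in a series that is linear in \<open>h\<close>: the coefficient of \<open>v\<close> collects
  all words obtained by inserting one letter \<open>h\<close> into \<open>v\<close>.
\<close>

definition at_one :: "zwh series \<Rightarrow> zw series" where
  "at_one F = (\<lambda>v. \<Sum>i\<le>length v. F (map Var (take i v) @ H # map Var (drop i v)))"

definition pd_tilde :: "zw \<Rightarrow> zw series \<Rightarrow> zw series" where
  "pd_tilde x f = at_one (pd_hat x f)"


section \<open>Bidegree full series\<close>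

definition S :: "nat \<Rightarrow> nat \<Rightarrow> zw series" where
  "S p q = (\<lambda>v. if count_list v Z = p \<and> count_list v W = q then 1 else 0)"

definition bidegree_full :: "zw series \<Rightarrow> bool" where
  "bidegree_full f \<longleftrightarrow>
    (\<exists>a. f = series_sum (\<lambda>(p, q). S p q \<odot> a p q) UNIV) \<and>
    (\<forall>z w. summable (hom_part (case_zw z w) f))"


section \<open>Vector fields and rotor\<close>

type_synonym vector_field = "zw series \<times> zw series"

definition VH1 :: "vector_field set" where
  "VH1 = H1 \<times> H1"

definition bidegree_full_vf :: "vector_field \<Rightarrow> bool" where
  "bidegree_full_vf X \<longleftrightarrow> bidegree_full (fst X) \<and> bidegree_full (snd X)"

definition Rot :: "vector_field \<Rightarrow> zwh series" where
  "Rot X = - pd_hat Z (snd X) + pd_hat W (fst X)"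

text \<open>The series \<open>h r(z, w)\<close>.\<close>

definition h_times :: "zw series \<Rightarrow> zwh series" where
  "h_times r = (\<lambda>u. if u \<noteq> [] \<and> hd u = H \<and> H \<notin> set (tl u) then r (map the_var (tl u)) else 0)"

text \<open>
  No convergence is asked of the rotor; \<open>r\<close> is determined by \<open>h r\<close>, so \<open>rot X\<close> is well defined
  whenever \<open>X\<close> has rotor.
\<close>

definition has_rotor :: "vector_field \<Rightarrow> bool" where
  "has_rotor X \<longleftrightarrow> (\<exists>r. Rot X = h_times r)"

definition rot :: "vector_field \<Rightarrow> zw series" where
  "rot X = (THE r. Rot X = h_times r)"

lemma h_times_inject: "h_times r = h_times s \<Longrightarrow> r = s"
proof
  fix v assume "h_times r = h_times s"
  then have "h_times r (H # map Var v) = h_times s (H # map Var v)" by simp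
  moreover have "h_times t (H # map Var v) = t v" for t
    by (auto simp: h_times_def o_def)
  ultimately show "r v = s v" by simp
qed

lemma rot_eqI: "Rot X = h_times r \<Longrightarrow> rot X = r"
  unfolding rot_def by (rule the_equality) (simp_all add: h_times_inject)

lemma Rot_eq: "has_rotor X \<Longrightarrow> Rot X = h_times (rot X)"
  using rot_eqI by (fastforce simp only: has_rotor_def)


section \<open>The formal derivative is the limit of difference quotients\<close>

lemma finite_words: "finite {v :: 'a::finite list. length v = d}"
  using finite_lists_length_eq[of "UNIV :: 'a set" d] by simp

lemma UNIV_zw: "UNIV = {Z, W}"
proof (rule UNIV_eq_I)
  show "x \<in> {Z, W}" for x
    by (cases x) auto
qed

lemma UNIV_zwh: "UNIV = {Var Z, Var W, H}"
proof (rule UNIV_eq_I)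
  show "x \<in> {Var Z, Var W, H}" for x
    by (cases x; cases "the_var x") auto
qed

instance zw :: finite by standard (simp add: UNIV_zw)
instance zwh :: finite by standard (simp add: UNIV_zwh)

lemma hom_part_0: "hom_part e F 0 = F []"
  by (simp add: hom_part_def)

lemma hom_part_Suc:
  fixes e :: "'a::finite \<Rightarrow> quat"
  shows "hom_part e F (Suc d) = (\<Sum>x\<in>UNIV. e x * hom_part e (\<lambda>v. F (x # v)) d)"
proof -
  have "hom_part e F (Suc d)
      = (\<Sum>(x, v)\<in>UNIV \<times> {v. length v = d}. prod_list (map e (x # v)) * F (x # v))"
    unfolding hom_part_def
    by (rule sum.reindex_bij_witness[of _ "\<lambda>(x, v). x # v" "\<lambda>u. (hd u, tl u)"])
      (auto simp: length_Suc_conv)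
  then show ?thesis
    by (simp add: hom_part_def sum.cartesian_product[symmetric] sum_distrib_left mult.assoc)
qed

lemma hom_part_no_h:
  "hom_part (case_zwh e h) (\<lambda>u. if H \<notin> set u then f (map (case_zwh (\<lambda>y. y) x) u) else 0) d
    = hom_part e f d"
proof (induction d arbitrary: f)
  case (Suc d)
  show ?case
    using Suc.IH[of "\<lambda>v. f (Z # v)"] Suc.IH[of "\<lambda>v. f (W # v)"]
    by (simp add: hom_part_Suc UNIV_zw UNIV_zwh cong: if_cong) (simp add: hom_part_def)
qed (simp add: hom_part_0)

lemma pd_hat_Cons_Var: "pd_hat x f (Var y # u) = pd_hat x (\<lambda>v. f (y # v)) u"
  by (simp add: pd_hat_def)

lemma pd_hat_Cons_H:
  "pd_hat x f (H # u) = (if H \<notin> set u then f (x # map (case_zwh (\<lambda>y. y) x) u) else 0)"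
  by (simp add: pd_hat_def count_list_0_iff)

lemma pd_hat_has_derivative:
  "((\<lambda>t. hom_part (e(x := e x + t *\<^sub>R h)) f d) has_vector_derivative
     hom_part (case_zwh e h) (pd_hat x f) d) (at 0)"
proof (induction d arbitrary: f)
  case 0
  show ?case by (simp add: hom_part_0 pd_hat_def)
next
  case (Suc d)
  let ?e = "\<lambda>t. e(x := e x + t *\<^sub>R h)"
  let ?D = "\<lambda>y. hom_part (case_zwh e h) (pd_hat x (\<lambda>v. f (y # v))) d"
  let ?f = "\<lambda>y. hom_part e (\<lambda>v. f (y # v)) d"
  have pt: "((\<lambda>t. ?e t y) has_vector_derivative (if y = x then h else 0)) (at 0)" for y
    by (auto intro!: derivative_eq_intros)
  have "((\<lambda>t. ?e t y * hom_part (?e t) (\<lambda>v. f (y # v)) d) has_vector_derivative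
      (e y * ?D y + (if y = x then h else 0) * ?f y)) (at 0)" for y
    using has_vector_derivative_mult[OF pt[of y] Suc.IH[of "\<lambda>v. f (y # v)"]]
    by (rule has_vector_derivative_eq_rhs) simp
  then have "((\<lambda>t. hom_part (?e t) f (Suc d)) has_vector_derivative
      (\<Sum>y\<in>UNIV. e y * ?D y + (if y = x then h else 0) * ?f y)) (at 0)"
    unfolding hom_part_Suc by (intro has_vector_derivative_sum)
  also have "(\<Sum>y\<in>UNIV. e y * ?D y + (if y = x then h else 0) * ?f y)
      = (\<Sum>y\<in>UNIV. e y * ?D y) + h * ?f x"
    by (simp add: sum.distrib if_distrib[of "\<lambda>a. a * _"] cong: if_cong)
  also have "\<dots> = hom_part (case_zwh e h) (pd_hat x f) (Suc d)"
    using hom_part_no_h[of e h "\<lambda>v. f (x # v)" x d]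
    by (simp add: hom_part_Suc UNIV_zw UNIV_zwh pd_hat_Cons_Var pd_hat_Cons_H)
  finally show ?case .
qed

end

theory Submission
  imports Defs "HOL-Computational_Algebra.Polynomial"
begin

text \<open>
  Write \<open>f(u)\<close> for the coefficient of the word \<open>u\<close> in \<open>f\<close>. Comparing coefficients in
  \<open>Rot X[h] = h r\<close> at words that contain one letter \<open>h\<close> gives two families of equations
  (\<open>rotor_coefficients\<close>): \<open>f(u w v) = g(u z v)\<close> for nonempty \<open>u\<close>, and \<open>r(v) = f(w v) - g(z v)\<close>.
  They imply that \<open>r(u z w v) = r(u w z v)\<close> (\<open>rotor_swap_invariant\<close>). Adjacent letters of a word may
  thus be exchanged without changing its coefficient in \<open>r\<close>, so this coefficient
  depends on the bidegree alone.

  The analytic point is that \<open>r\<close> converges. Absolute convergence of \<open>f\<close> and \<open>g\<close> at every point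
  does not in general bound the coefficient of a single word, since the values of a series of words
  on the quaternions do not determine it. It does control the sum of the coefficients over all words of one
  bidegree: these sums are the coefficients of the commutative polynomials obtained at real
  points. Pointwise bounds on polynomials hold uniformly on a set of measure at least one half, and
  Lagrange interpolation at well separated points of such a set bounds the coefficients with a
  loss that is only exponential in the degree (\<open>coefficient_bound_on_large_set\<close>). Since convergence
  is available at arbitrarily large real points, the sums over bidegrees decay faster than any
  geometric sequence (\<open>letter_sum_bound\<close>). The coefficient of \<open>r\<close> in bidegree \<open>(p, q)\<close>, multiplied by
  the number of words of this bidegree, is \<open>q + 1\<close> times the sum for \<open>f\<close> in bidegree \<open>(p, q + 1)\<close>
  minus \<open>p + 1\<close> times the sum for \<open>g\<close> in bidegree \<open>(p + 1, q)\<close>, so \<open>r\<close> converges everywhere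
  (\<open>rotor_in_H1\<close>).

  If \<open>r = 0\<close>, then \<open>f(u w v) = g(u z v)\<close> for all \<open>u\<close>. Now the coefficients of \<open>f\<close> and \<open>g\<close> themselves
  are invariant under exchanging adjacent letters, and those of \<open>f\<close> in bidegree \<open>(p - 1, q)\<close> agree
  with those of \<open>g\<close> in bidegree \<open>(p, q - 1)\<close>. The series \<open>\<chi>\<close> of the statement is the one with
  homogeneous parts \<open>\<chi>\<^sub>d = (z f\<^bsub>d-1\<^esub> + w g\<^bsub>d-1\<^esub>) / d\<close>; in this form its convergence is evident
  (\<open>potential_in_H1\<close>). It depends on the bidegree as well, so the \<open>d\<close> ways of inserting a letter in
  a word of length \<open>d - 1\<close> contribute equally to a partial derivative and cancel the factor \<open>1 / d\<close>
  (\<open>pd_tilde_potential\<close>).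
\<close>

section \<open>Series that depend only on the bidegree\<close>

text \<open>
  Each of the four real components is dominated by the norm, so completeness of the real numbers
  suffices.
\<close>

lemma quat_summable_norm_cancel:
  fixes f :: "nat \<Rightarrow> quat"
  assumes "summable (\<lambda>n. norm (f n))"
  shows "summable f"
proof -
  have component: "\<bar>qre x\<bar> \<le> norm x" "\<bar>qi x\<bar> \<le> norm x" "\<bar>qj x\<bar> \<le> norm x" "\<bar>qk x\<bar> \<le> norm x" for x
    by (auto simp: norm_quat_def intro!: real_le_rsqrt)
  have part: "summable (\<lambda>n. p (f n) *\<^sub>R e)" if "\<And>x. \<bar>p x\<bar> \<le> norm x" for p and e :: quat
  proof (rule bounded_linear.summable[OF bounded_linear_scaleR_left])
    show "summable (\<lambda>n. p (f n))"
      using that by (intro summable_comparison_test'[OF assms, where N = 0]) simp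
  qed
  have "f = (\<lambda>n. qre (f n) *\<^sub>R Quat 1 0 0 0 + qi (f n) *\<^sub>R Quat 0 1 0 0
      + qj (f n) *\<^sub>R Quat 0 0 1 0 + qk (f n) *\<^sub>R Quat 0 0 0 1)"
    by (auto simp: quat_eq_iff plus_quat_def scaleR_quat_def)
  then show ?thesis
    by (rule ssubst) (intro summable_add part component)
qed

lemma series_sum_single:
  assumes "\<And>i. i \<in> I \<Longrightarrow> i \<noteq> k \<Longrightarrow> F i v = 0"
  shows "series_sum F I v = (if k \<in> I then F k v else 0)"
proof -
  have "{i \<in> I. F i v \<noteq> 0} = (if k \<in> I \<and> F k v \<noteq> 0 then {k} else {})"
    using assms by auto
  then show ?thesis by (simp add: series_sum_def)
qed

definition normal_word :: "nat \<Rightarrow> nat \<Rightarrow> zw list" where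
  "normal_word p q = replicate p Z @ replicate q W"

text \<open>
  Bubble sort: a word is carried to the word with the same letters and all \<open>z\<close> in front by
  exchanging adjacent letters. This turns the coefficient identities for a rotor, which are local
  in the word, into dependence on the bidegree alone.
\<close>

lemma swap_invariant_sort:
  assumes swap: "\<And>u v. F (u @ Z # W # v) = F (u @ W # Z # v)"
  shows "F v = F (normal_word (count_list v Z) (count_list v W))"
proof -
  have move: "F (u @ W # replicate p Z @ v) = F (u @ replicate p Z @ W # v)" for p u v
  proof (induction p arbitrary: u)
    case (Suc p)
    show ?case using Suc.IH[of "u @ [Z]"] swap[of u] by simp
  qed simp
  have "F (u @ v) = F (u @ replicate (count_list v Z) Z @ replicate (count_list v W) W)" for u
  proof (induction v arbitrary: u)
    case (Cons y v)
    show ?case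
      using Cons.IH[of "u @ [y]"] move[of u "count_list v Z" "replicate (count_list v W) W"]
      by (cases y) simp_all
  qed simp
  from this[of "[]"] show ?thesis by (simp add: normal_word_def)
qed

lemma bidegree_fullI:
  assumes swap: "\<And>u v. F (u @ Z # W # v) = F (u @ W # Z # v)" and "F \<in> H1"
  shows "bidegree_full F"
proof -
  have "F = series_sum (\<lambda>(p, q). S p q \<odot> F (normal_word p q)) UNIV"
  proof
    fix v
    have "series_sum (\<lambda>(p, q). S p q \<odot> F (normal_word p q)) UNIV v
        = F (normal_word (count_list v Z) (count_list v W))"
      by (subst series_sum_single[where k = "(count_list v Z, count_list v W)"])
        (auto simp: S_def rmult_def split: if_splits)
    then show "F v = series_sum (\<lambda>(p, q). S p q \<odot> F (normal_word p q)) UNIV v"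
      using swap_invariant_sort[of F v, OF swap] by simp
  qed
  moreover have "summable (hom_part (case_zw z w) F)" for z w
  proof (rule quat_summable_norm_cancel)
    show "summable (\<lambda>d. norm (hom_part (case_zw z w) F d))"
      using \<open>F \<in> H1\<close> unfolding H1_def by blast
  qed
  ultimately show ?thesis
    unfolding bidegree_full_def by (intro conjI allI exI[where x = "\<lambda>p q. F (normal_word p q)"])
qed

lemma length_eq_counts: "count_list v Z + count_list v W = length v"
proof (induction v)
  case (Cons y v)
  then show ?case by (cases y) auto
qed simp

lemma mono_word_replicate:
  "mono_word (replicate p Z) = S p 0" "mono_word (replicate p W) = S 0 p"
proof -
  have rep: "v = replicate n x \<longleftrightarrow> length v = n \<and> set v \<subseteq> {x}" for v :: "zw list" and n x
    by (auto intro!: replicate_eqI)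
  have only: "(set v \<subseteq> {Z} \<longleftrightarrow> count_list v W = 0) \<and> (set v \<subseteq> {W} \<longleftrightarrow> count_list v Z = 0)" for v
  proof (induction v)
    case (Cons y v)
    then show ?case by (cases y) simp_all
  qed simp
  have "v = replicate p Z \<longleftrightarrow> count_list v Z = p \<and> count_list v W = 0"
    "v = replicate p W \<longleftrightarrow> count_list v Z = 0 \<and> count_list v W = p" for v
    unfolding rep using only[of v] length_eq_counts[of v] by auto
  then show "mono_word (replicate p Z) = S p 0" "mono_word (replicate p W) = S 0 p"
    unfolding mono_word_def S_def by presburger+
qed

section \<open>Coefficients of a polynomial from its values at separated points\<close>

definition lagrange_basis :: "real set \<Rightarrow> real \<Rightarrow> real poly" where
  "lagrange_basis T t = (\<Prod>s\<in>T - {t}. smult (1 / (t - s)) [:- s, 1:])"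

lemma poly_lagrange_basis:
  assumes "finite T" "s \<in> T"
  shows "poly (lagrange_basis T t) s = (if s = t then 1 else 0)"
proof -
  have "poly (lagrange_basis T t) s = (\<Prod>r\<in>T - {t}. (s - r) / (t - r))"
    by (simp add: lagrange_basis_def poly_prod diff_divide_distrib)
  also have "\<dots> = (if s = t then 1 else 0)"
    using assms by (auto intro!: prod.neutral)
  finally show ?thesis .
qed

lemma degree_lagrange_basis:
  assumes "finite T" "t \<in> T"
  shows "degree (lagrange_basis T t) < card T"
proof -
  have "degree (lagrange_basis T t) \<le> (\<Sum>s\<in>T - {t}. degree (smult (1 / (t - s)) [:- s, 1:]))"
    using degree_prod_sum_le[OF finite_Diff[OF assms(1)], of "\<lambda>s. smult (1 / (t - s)) [:- s, 1:]" "{t}"]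
    unfolding lagrange_basis_def o_def .
  also have "\<dots> \<le> (\<Sum>s\<in>T - {t}. 1)"
    by (intro sum_mono) (simp add: degree_smult_le)
  also have "\<dots> < card T"
    using card_Diff1_less[OF assms] by simp
  finally show ?thesis .
qed

lemma lagrange_interpolation:
  assumes T: "finite T" and deg: "degree p < card T"
  shows "p = (\<Sum>t\<in>T. smult (poly p t) (lagrange_basis T t))"
proof (rule poly_eqI_degree[of T])
  show "poly p s = poly (\<Sum>t\<in>T. smult (poly p t) (lagrange_basis T t)) s" if "s \<in> T" for s
    using T that by (simp add: poly_sum poly_lagrange_basis if_distrib[of "\<lambda>a. _ * a"] cong: if_cong)
  have "degree (smult (poly p t) (lagrange_basis T t)) \<le> card T - 1" if "t \<in> T" for t
    using degree_lagrange_basis[OF T that] degree_smult_le[of "poly p t" "lagrange_basis T t"]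
    by linarith
  then have "degree (\<Sum>t\<in>T. smult (poly p t) (lagrange_basis T t)) \<le> card T - 1"
    by (intro degree_sum_le T)
  then show "degree (\<Sum>t\<in>T. smult (poly p t) (lagrange_basis T t)) < card T"
    using deg by linarith
qed (fact deg)

text \<open>
  Read with \<open>n\<close> fixed, the interpolation formula for the monomials says that the \<open>n\<close>-th
  coefficient is a linear functional of the values, with real weights that are the same for all
  polynomials of degree at most \<open>d\<close>. Real weights act on any real vector space, so
  the coefficients \<open>c\<close> may be quaternions.
\<close>

lemma coefficient_from_values:
  fixes c :: "nat \<Rightarrow> 'a::real_vector"
  assumes T: "finite T" "card T = Suc d" and n: "n \<le> d"
  shows "c n = (\<Sum>t\<in>T. coeff (lagrange_basis T t) n *\<^sub>R (\<Sum>j\<le>d. t ^ j *\<^sub>R c j))"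
proof -
  have kron: "(\<Sum>t\<in>T. coeff (lagrange_basis T t) n * t ^ j) = (if j = n then 1 else 0)"
    if "j \<le> d" for j
  proof -
    have "monom 1 j = (\<Sum>t\<in>T. smult (t ^ j) (lagrange_basis T t))"
      using lagrange_interpolation[of T "monom 1 j"] T that
      by (simp add: degree_monom_eq poly_monom)
    then have "coeff (monom (1::real) j) n = coeff (\<Sum>t\<in>T. smult (t ^ j) (lagrange_basis T t)) n"
      by simp
    then show ?thesis by (simp add: coeff_sum mult.commute)
  qed
  have "(\<Sum>t\<in>T. coeff (lagrange_basis T t) n *\<^sub>R (\<Sum>j\<le>d. t ^ j *\<^sub>R c j))
      = (\<Sum>j\<le>d. (\<Sum>t\<in>T. coeff (lagrange_basis T t) n * t ^ j) *\<^sub>R c j)"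
    by (simp add: scaleR_sum_right scaleR_sum_left) (rule sum.swap)
  also have "\<dots> = (\<Sum>j\<le>d. if j = n then c j else 0)"
    by (intro sum.cong) (auto simp: kron)
  finally show ?thesis using n by simp
qed

lemma coeff_prod_linear_le:
  assumes "finite A" "\<And>s. s \<in> A \<Longrightarrow> \<bar>s\<bar> \<le> (1::real)"
  shows "\<bar>coeff (\<Prod>s\<in>A. [:- s, 1:]) n\<bar> \<le> 2 ^ card A"
  using assms
proof (induction A arbitrary: n)
  case empty
  show ?case by (cases n) auto
next
  case (insert s A)
  let ?P = "\<Prod>s\<in>A. [:- s, 1:]"
  have IH: "\<bar>coeff ?P m\<bar> \<le> 2 ^ card A" for m
    using insert by simp
  have s: "\<bar>s\<bar> * \<bar>coeff ?P n\<bar> \<le> 1 * 2 ^ card A"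
    using insert.prems IH[of n] by (intro mult_mono) auto
  have shifted: "\<bar>coeff (pCons 0 ?P) n\<bar> \<le> 2 ^ card A"
    using IH by (cases n) auto
  have "coeff ([:- s, 1:] * ?P) n = coeff (pCons 0 ?P) n - s * coeff ?P n"
    by (simp add: coeff_pCons)
  then have "\<bar>coeff ([:- s, 1:] * ?P) n\<bar> \<le> \<bar>coeff (pCons 0 ?P) n\<bar> + \<bar>s\<bar> * \<bar>coeff ?P n\<bar>"
    using abs_triangle_ineq4[of "coeff (pCons 0 ?P) n" "s * coeff ?P n"] by (simp add: abs_mult)
  with s shifted show ?case using insert.hyps by simp
qed

lemma coeff_lagrange_basis_le:
  assumes T: "finite T" "t \<in> T" "T \<subseteq> {0..1}" "card T = Suc d"
    and sep: "1 / B \<le> (\<Prod>s\<in>T - {t}. \<bar>t - s\<bar>)" and B: "B > 0"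
  shows "\<bar>coeff (lagrange_basis T t) n\<bar> \<le> 2 ^ d * B"
proof -
  have c: "card (T - {t}) = d" using T by simp
  let ?D = "\<Prod>s\<in>T - {t}. \<bar>t - s\<bar>"
  have "\<bar>coeff (lagrange_basis T t) n\<bar> = \<bar>coeff (\<Prod>s\<in>T - {t}. [:- s, 1:]) n\<bar> / ?D"
    by (simp add: lagrange_basis_def prod_smult abs_mult abs_prod prod_dividef del: smult_pCons)
  also have "\<dots> \<le> 2 ^ d / ?D"
  proof (rule divide_right_mono)
    have "\<bar>s\<bar> \<le> 1" if "s \<in> T - {t}" for s
      using that T by force
    then show "\<bar>coeff (\<Prod>s\<in>T - {t}. [:- s, 1:]) n\<bar> \<le> 2 ^ d"
      using coeff_prod_linear_le[of "T - {t}" n] T c by (metis finite_Diff)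
  qed (simp add: prod_nonneg)
  also have "\<dots> \<le> 2 ^ d / (1 / B)"
    using sep B by (intro divide_left_mono mult_pos_pos) (auto intro: less_le_trans[of 0 "1 / B"])
  finally show ?thesis by simp
qed

lemma fact_card_le_prod:
  fixes A :: "nat set"
  assumes "finite A" "0 \<notin> A"
  shows "fact (card A) \<le> \<Prod>A"
  using assms
proof (induction A rule: finite_linorder_max_induct)
  case (insert b A)
  have "insert b A \<subseteq> {1..b}"
    using insert.hyps insert.prems by (auto simp: Suc_le_eq less_imp_le intro: gr0I)
  then have "Suc (card A) \<le> b"
    using card_mono[of "{1..b}" "insert b A"] insert by (auto simp: card_insert_if)
  moreover have "fact (card A) \<le> \<Prod>A" using insert by simp
  ultimately have "Suc (card A) * fact (card A) \<le> b * \<Prod>A" by (rule mult_mono) auto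
  moreover have "b \<notin> A" using insert by auto
  ultimately show ?case using insert by simp
qed simp

text \<open>
  The distances to the smaller elements of \<open>K\<close> are distinct positive integers, and so are the
  distances to the larger ones. So the two products are at least \<open>i!\<close> and \<open>j!\<close> with
  \<open>i + j = d\<close>, and \<open>d! / (i! j!)\<close> is a binomial coefficient.
\<close>

lemma prod_nat_distances_ge:
  assumes K: "finite K" "k \<in> K" "card K = Suc d"
  shows "fact d / 2 ^ d \<le> (\<Prod>l\<in>K - {k}. \<bar>real k - real l\<bar>)"
proof -
  let ?A = "{l \<in> K. l < k}" and ?B = "{l \<in> K. k < l}"
  have split: "K - {k} = ?A \<union> ?B" "?A \<inter> ?B = {}" by auto
  have card: "card ?A + card ?B = d"
  proof -
    have "card ?A + card ?B = card (K - {k})"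
      unfolding split(1) using K split(2) by (intro card_Un_disjoint[symmetric]) auto
    then show ?thesis using K by simp
  qed
  have below: "fact (card ?A) \<le> (\<Prod>l\<in>?A. \<bar>real k - real l\<bar>)"
  proof -
    have inj: "inj_on (\<lambda>l. k - l) ?A" by (auto simp: inj_on_def)
    have "fact (card ?A) \<le> (\<Prod>l\<in>?A. k - l)"
      using fact_card_le_prod[of "(\<lambda>l. k - l) ` ?A"] inj K
      by (simp add: card_image prod.reindex) (auto simp: image_iff)
    then have "real (fact (card ?A)) \<le> real (\<Prod>l\<in>?A. k - l)" by (rule of_nat_mono)
    also have "\<dots> = (\<Prod>l\<in>?A. \<bar>real k - real l\<bar>)"
      by (simp only: of_nat_prod) (intro prod.cong, auto)
    finally show ?thesis by simp
  qed
  have above: "fact (card ?B) \<le> (\<Prod>l\<in>?B. \<bar>real k - real l\<bar>)"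
  proof -
    have inj: "inj_on (\<lambda>l. l - k) ?B" by (auto simp: inj_on_def)
    have "fact (card ?B) \<le> (\<Prod>l\<in>?B. l - k)"
      using fact_card_le_prod[of "(\<lambda>l. l - k) ` ?B"] inj K
      by (simp add: card_image prod.reindex) (auto simp: image_iff)
    then have "real (fact (card ?B)) \<le> real (\<Prod>l\<in>?B. l - k)" by (rule of_nat_mono)
    also have "\<dots> = (\<Prod>l\<in>?B. \<bar>real k - real l\<bar>)"
      by (simp only: of_nat_prod) (intro prod.cong, auto)
    finally show ?thesis by simp
  qed
  have "card ?A \<le> d" "d - card ?A = card ?B"
    using card by linarith+
  then have "fact (card ?A) * fact (card ?B) * (d choose card ?A) = (fact d :: nat)"
    using binomial_fact_lemma[of "card ?A" d] by (simp only:)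
  moreover have "fact (card ?A) * fact (card ?B) * (d choose card ?A)
      \<le> fact (card ?A) * fact (card ?B) * 2 ^ d"
    by (intro mult_le_mono2 binomial_le_pow2)
  ultimately have "(fact d :: nat) \<le> fact (card ?A) * fact (card ?B) * 2 ^ d"
    by (simp only:)
  then have "real (fact d) \<le> real (fact (card ?A) * fact (card ?B) * 2 ^ d)" by (rule of_nat_mono)
  then have "fact d / 2 ^ d \<le> (fact (card ?A) * fact (card ?B) :: real)"
    by (simp add: divide_le_eq)
  also have "\<dots> \<le> (\<Prod>l\<in>?A. \<bar>real k - real l\<bar>) * (\<Prod>l\<in>?B. \<bar>real k - real l\<bar>)"
    using below above by (intro mult_mono) (auto intro: prod_nonneg)
  also have "\<dots> = (\<Prod>l\<in>K - {k}. \<bar>real k - real l\<bar>)"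
    using K split by (subst prod.union_disjoint[symmetric]) auto
  finally show ?thesis .
qed

lemma power_le_fact_mult_exp:
  assumes "x \<ge> (0::real)"
  shows "x ^ n \<le> fact n * exp x"
proof -
  have "x ^ n /\<^sub>R fact n \<le> (\<Sum>k. x ^ k /\<^sub>R fact k)"
    using assms summable_exp_generic[of x] sum_le_suminf[of "\<lambda>k. x ^ k /\<^sub>R fact k" "{n}"] by simp
  then show ?thesis by (simp add: exp_def field_simps)
qed

section \<open>Separated points in a set of large measure\<close>

text \<open>
  The occupied cells cover \<open>E\<close> and each has length \<open>1 / N\<close>.
\<close>

lemma card_occupied_cells_ge:
  fixes E :: "real set"
  assumes E: "E \<in> sets lborel" "E \<subseteq> {0..1}" "1 / 2 \<le> measure lborel E" and N: "N > 0"
  shows "N \<le> 2 * card {k. k < N \<and> E \<inter> {real k / N..real (Suc k) / N} \<noteq> {}}"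
proof -
  let ?K = "{k. k < N \<and> E \<inter> {real k / N..real (Suc k) / N} \<noteq> {}}"
  let ?I = "\<lambda>k. {real k / N..real (Suc k) / N}"
  have "E \<subseteq> (\<Union>k\<in>?K. ?I k)"
  proof
    fix t assume t: "t \<in> E"
    with E have t01: "0 \<le> t" "t \<le> 1" by auto
    define k where "k = (if t = 1 then N - 1 else nat \<lfloor>t * N\<rfloor>)"
    have "k < N \<and> real k \<le> t * N \<and> t * N \<le> real (Suc k)"
    proof (cases "t = 1")
      case True
      then show ?thesis using N by (simp add: k_def)
    next
      case False
      then have "t < 1" using t01 by linarith
      then have "t * N < N" using N by simp
      moreover have "0 \<le> t * N" using t01 by simp
      moreover have "real k = of_int \<lfloor>t * N\<rfloor>"
        using False \<open>0 \<le> t * N\<close> by (simp add: k_def)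
      ultimately show ?thesis
        using floor_correct[of "t * N"] by linarith
    qed
    then have "k < N" "t \<in> ?I k" using N by (simp_all add: pos_divide_le_eq pos_le_divide_eq)
    with t show "t \<in> (\<Union>k\<in>?K. ?I k)" by blast
  qed
  then have "measure lborel E \<le> measure lborel (\<Union>k\<in>?K. ?I k)"
    by (intro measure_mono_fmeasurable) (use E in \<open>auto intro!: fmeasurable_compact compact_UN\<close>)
  also have "\<dots> \<le> (\<Sum>k\<in>?K. measure lborel (?I k))"
    by (intro measure_UNION_le) auto
  also have "\<dots> = card ?K / N"
    using N by (simp add: field_simps)
  finally have "1 / 2 \<le> real (card ?K) / N" using E(3) by linarith
  moreover have "N \<le> 2 * c" if "1 / 2 \<le> real c / N" for c :: nat
    using that N by (simp add: field_simps)
  ultimately show ?thesis by blast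
qed

text \<open>
  What matters is that the lower bound is only exponentially small in \<open>d\<close> and that its base does
  not depend on \<open>E\<close>. Cut \<open>[0, 1]\<close> into \<open>4 (d + 1)\<close> cells. At least half of them meet \<open>E\<close>, and
  at least \<open>d + 1\<close> of those have indices of the same parity. One point from each of these cells
  gives points at least half as far apart as the left ends of their cells. Hence the product of
  the distances is at least \<open>d! / (4 N)^d\<close> with \<open>N = 4 (d + 1)\<close>, and \<open>N^d \<le> d! e^N\<close>.
\<close>

lemma separated_points_in_large_set:
  fixes E :: "real set"
  assumes E: "E \<in> sets lborel" "E \<subseteq> {0..1}" "1 / 2 \<le> measure lborel E"
  obtains T where "T \<subseteq> E" "finite T" "card T = Suc d"
    "\<And>t. t \<in> T \<Longrightarrow> 1 / (4 * exp 4) ^ Suc d \<le> (\<Prod>s\<in>T - {t}. \<bar>t - s\<bar>)"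
proof -
  define N where "N = 4 * Suc d"
  have N: "N > 0" by (simp add: N_def)
  let ?hit = "\<lambda>k. E \<inter> {real k / N..real (Suc k) / N} \<noteq> {}"
  let ?K = "{k. k < N \<and> ?hit k}"
  have K: "N \<le> 2 * card ?K" using card_occupied_cells_ge[OF E N] .
  have "card ?K = card {k \<in> ?K. even k} + card {k \<in> ?K. odd k}"
    by (subst card_Un_disjoint[symmetric]) (auto intro!: arg_cong[where f = card])
  moreover have "Suc d \<le> a \<or> Suc d \<le> b" if "N \<le> 2 * c" "c = a + b" for a b c
    using that unfolding N_def by presburger
  ultimately have "Suc d \<le> card {k \<in> ?K. even k} \<or> Suc d \<le> card {k \<in> ?K. odd k}"
    using K by blast
  then obtain P :: "nat \<Rightarrow> bool" where P: "P = even \<or> P = odd" "Suc d \<le> card {k \<in> ?K. P k}"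
    by blast
  obtain L where L: "L \<subseteq> {k \<in> ?K. P k}" "card L = Suc d" "finite L"
    using obtain_subset_with_card_n[OF P(2)] .
  have "\<forall>k\<in>L. \<exists>t. t \<in> E \<inter> {real k / N..real (Suc k) / N}"
    using L(1) by blast
  then obtain \<tau> where \<tau>: "\<And>k. k \<in> L \<Longrightarrow> \<tau> k \<in> E \<inter> {real k / N..real (Suc k) / N}"
    by metis
  have gap: "\<bar>real k - real l\<bar> / (2 * N) \<le> \<bar>\<tau> k - \<tau> l\<bar>" if "k \<in> L" "l \<in> L" for k l
  proof (cases "k = l")
    case False
    have *: "(real l - real k) / (2 * N) \<le> \<tau> l - \<tau> k" if "k \<in> L" "l \<in> L" "k < l" for k l
    proof -
      \<comment> \<open>Equal parity rules out neighbouring cells, so that \<open>l - k - 1 \<ge> (l - k) / 2\<close>.\<close>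
      have "even (k + l)" using P(1) L(1) that by auto
      then have "l \<noteq> Suc k" by auto
      with that have "real k + 2 \<le> real l" by linarith
      moreover have "\<tau> k * N \<le> real (Suc k)" "real l \<le> \<tau> l * N"
        using \<tau>[OF that(1)] \<tau>[OF that(2)] N by (simp_all add: pos_divide_le_eq pos_le_divide_eq)
      ultimately have "real l - real k \<le> 2 * (\<tau> l * N - \<tau> k * N)" by simp
      also have "\<dots> = (\<tau> l - \<tau> k) * (2 * N)" by (simp add: algebra_simps)
      finally show ?thesis using N by (simp add: pos_divide_le_eq)
    qed
    show ?thesis
    proof (cases "k < l")
      case True
      with *[of k l] that show ?thesis by (auto simp: abs_if)
    next
      case False
      with \<open>k \<noteq> l\<close> *[of l k] that show ?thesis by (auto simp: abs_if)
    qed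
  qed simp
  have inj: "inj_on \<tau> L"
  proof (rule inj_onI)
    fix k l assume "k \<in> L" "l \<in> L" "\<tau> k = \<tau> l"
    with gap[of k l] N show "k = l" by (simp add: divide_le_0_iff)
  qed
  show thesis
  proof
    show "\<tau> ` L \<subseteq> E" using \<tau> by blast
    show "finite (\<tau> ` L)" "card (\<tau> ` L) = Suc d"
      using L inj by (simp_all add: card_image)
    fix t assume "t \<in> \<tau> ` L"
    then obtain k where k: "k \<in> L" "t = \<tau> k" by blast
    have cd: "card (L - {k}) = d" using L k by simp
    have "real N ^ d \<le> fact d * exp (real N)"
      by (rule power_le_fact_mult_exp) simp
    moreover have "exp (real N) = exp 4 ^ Suc d"
      by (simp only: exp_of_nat_mult[symmetric] N_def) (simp add: algebra_simps)
    ultimately have 1: "1 / exp 4 ^ Suc d \<le> fact d / real N ^ d"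
      using N by (simp add: field_simps)
    have "1 / (4 * exp 4) ^ Suc d \<le> (1 / 4 ^ d) * (1 / exp (4::real) ^ Suc d)"
      by (simp add: power_mult_distrib field_simps)
    also have "\<dots> \<le> (1 / 4 ^ d) * (fact d / real N ^ d)"
      using 1 by (intro mult_left_mono) auto
    also have "\<dots> = fact d / 2 ^ d / (2 * N) ^ d"
    proof -
      have "(4::real) ^ d = 2 ^ d * 2 ^ d" by (simp flip: power_mult_distrib)
      then show ?thesis by (simp add: power_mult_distrib)
    qed
    also have "\<dots> \<le> (\<Prod>l\<in>L - {k}. \<bar>real k - real l\<bar>) / (2 * N) ^ d"
      using prod_nat_distances_ge[of L k d] L k by (intro divide_right_mono) auto
    also have "\<dots> = (\<Prod>l\<in>L - {k}. \<bar>real k - real l\<bar> / (2 * N))"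
      using cd by (simp add: prod_dividef)
    also have "\<dots> \<le> (\<Prod>l\<in>L - {k}. \<bar>\<tau> k - \<tau> l\<bar>)"
      using gap k by (intro prod_mono) auto
    also have "\<dots> = (\<Prod>s\<in>\<tau> ` (L - {k}). \<bar>t - s\<bar>)"
      using k inj by (subst prod.reindex) (auto intro: inj_on_subset)
    also have "\<tau> ` (L - {k}) = \<tau> ` L - {t}"
      using k inj by (auto simp: inj_on_def)
    finally show "1 / (4 * exp 4) ^ Suc d \<le> (\<Prod>s\<in>\<tau> ` L - {t}. \<bar>t - s\<bar>)" .
  qed
qed

text \<open>
  A weak Remez inequality: a polynomial that is bounded by \<open>M\<close> on a set of measure at least one
  half, wherever that set lies in the unit interval, has coefficients bounded by \<open>M\<close> up to a
  factor that is exponential in the degree.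
\<close>

lemma coefficient_bound_on_large_set:
  fixes c :: "nat \<Rightarrow> 'a::real_normed_vector"
  assumes E: "E \<in> sets lborel" "E \<subseteq> {0..1}" "1 / 2 \<le> measure lborel E"
    and bound: "\<And>t. t \<in> E \<Longrightarrow> norm (\<Sum>j\<le>d. t ^ j *\<^sub>R c j) \<le> M" and n: "n \<le> d"
  shows "norm (c n) \<le> (16 * exp 4) ^ Suc d * M"
proof -
  obtain T where T: "T \<subseteq> E" "finite T" "card T = Suc d"
    and sep: "\<And>t. t \<in> T \<Longrightarrow> 1 / (4 * exp 4) ^ Suc d \<le> (\<Prod>s\<in>T - {t}. \<bar>t - s\<bar>)"
    using separated_points_in_large_set[OF E] by blast
  let ?B = "2 ^ d * (4 * exp 4) ^ Suc d :: real"
  obtain t0 where "t0 \<in> T" using T(3) by fastforce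
  then have "M \<ge> 0" using order_trans[OF norm_ge_zero bound[of t0]] T(1) by blast
  have "norm (c n) \<le> (\<Sum>t\<in>T. norm (coeff (lagrange_basis T t) n *\<^sub>R (\<Sum>j\<le>d. t ^ j *\<^sub>R c j)))"
    by (subst coefficient_from_values[OF T(2,3) n]) (rule norm_sum)
  also have "\<dots> \<le> (\<Sum>t\<in>T. ?B * M)"
  proof (rule sum_mono)
    fix t assume t: "t \<in> T"
    have "\<bar>coeff (lagrange_basis T t) n\<bar> \<le> ?B"
      using coeff_lagrange_basis_le[OF T(2) t _ T(3) sep[OF t]] T(1) E(2) by auto
    then show "norm (coeff (lagrange_basis T t) n *\<^sub>R (\<Sum>j\<le>d. t ^ j *\<^sub>R c j)) \<le> ?B * M"
      unfolding norm_scaleR using bound[of t] t T(1) by (intro mult_mono) auto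
  qed
  also have "\<dots> = real (Suc d) * 2 ^ d * ((4 * exp 4) ^ Suc d * M)"
    using T(3) by simp
  also have "\<dots> \<le> 2 ^ Suc d * 2 ^ Suc d * ((4 * exp 4) ^ Suc d * M)"
  proof (intro mult_right_mono mult_mono)
    show "real (Suc d) \<le> 2 ^ Suc d"
      using of_nat_less_two_power[of "Suc d", where 'a = real] by linarith
  qed (use \<open>M \<ge> 0\<close> in auto)
  also have "\<dots> = (16 * exp 4) ^ Suc d * M"
  proof -
    have "(16 * exp 4 :: real) ^ Suc d = 2 ^ Suc d * 2 ^ Suc d * (4 * exp 4) ^ Suc d"
      unfolding power_mult_distrib[symmetric] by simp
    then show ?thesis by (simp only: mult.assoc)
  qed
  finally show ?thesis .
qed

section \<open>Decay of the coefficient sums of a convergent series\<close>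

text \<open>
  At real points the variables commute, and these sums are all that can be seen of a series there.
\<close>

definition letter_sum :: "'a \<Rightarrow> 'a series \<Rightarrow> nat \<Rightarrow> nat \<Rightarrow> quat" where
  "letter_sum x f d n = (\<Sum>v | length v = d \<and> count_list v x = n. f v)"

definition marked_point :: "zw \<Rightarrow> real \<Rightarrow> real \<Rightarrow> zw \<Rightarrow> quat" where
  "marked_point x R t y = of_real (R * (if y = x then t else 1))"

lemma prod_list_marked_point:
  "prod_list (map (marked_point x R t) v) = of_real (R ^ length v * t ^ count_list v x)"
proof (induction v)
  case (Cons y v)
  have "prod_list (map (marked_point x R t) (y # v))
      = of_real (R * (if y = x then t else 1)) * of_real (R ^ length v * t ^ count_list v x)"
    by (simp only: list.map prod_list.Cons Cons) (simp only: marked_point_def)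
  also have "\<dots> = of_real (R ^ length (y # v) * t ^ count_list (y # v) x)"
    unfolding of_real_mult[symmetric] by (rule arg_cong[where f = of_real]) simp
  finally show ?case .
qed simp

lemma hom_part_marked_point:
  "hom_part (marked_point x R t) f d = R ^ d *\<^sub>R (\<Sum>n\<le>d. t ^ n *\<^sub>R letter_sum x f d n)"
proof -
  let ?V = "{v :: zw list. length v = d}"
  have "hom_part (marked_point x R t) f d = (\<Sum>v\<in>?V. R ^ d *\<^sub>R (t ^ count_list v x *\<^sub>R f v))"
    unfolding hom_part_def
    by (intro sum.cong refl) (simp only: prod_list_marked_point scaleR_conv_of_real of_real_mult
        mult.assoc mem_Collect_eq)
  also have "\<dots> = R ^ d *\<^sub>R (\<Sum>n\<le>d. \<Sum>v\<in>{v \<in> ?V. count_list v x = n}. t ^ count_list v x *\<^sub>R f v)"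
    by (subst sum.group) (auto simp: finite_words scaleR_sum_right count_le_length)
  also have "\<dots> = R ^ d *\<^sub>R (\<Sum>n\<le>d. t ^ n *\<^sub>R letter_sum x f d n)"
    by (simp add: letter_sum_def scaleR_sum_right)
  finally show ?thesis .
qed

lemma H1_marked_point_bounded:
  assumes "f \<in> H1"
  obtains M where "\<And>d. norm (hom_part (marked_point x R t) f d) \<le> M"
proof -
  have point: "case_zw (marked_point x R t Z) (marked_point x R t W) = marked_point x R t"
    by (rule ext) (simp split: zw.split)
  have "summable (\<lambda>d. norm (hom_part (case_zw (marked_point x R t Z) (marked_point x R t W)) f d))"
    using assms unfolding H1_def by blast
  then have s: "summable (\<lambda>d. norm (hom_part (marked_point x R t) f d))"
    by (simp only: point)
  show thesis
    by (rule that, use sum_le_suminf[OF s, of "{_}"] in simp)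
qed

text \<open>
  Convergence is known at each point separately, with no uniformity, whereas decay of the
  coefficient sums is a uniform statement. With one variable equal to \<open>R\<close> and the other equal to
  \<open>R t\<close>, the part of degree \<open>d\<close> is \<open>R^d\<close> times a polynomial in \<open>t\<close> whose coefficients are the
  sums in question. The closed sets \<open>E m\<close> of those \<open>t\<close> in \<open>[0, 1]\<close> at which all these parts are
  bounded by \<open>m\<close> increase to \<open>[0, 1]\<close>, so one of them has measure at least one half. On this set
  the bound is uniform. The exponential loss in passing to the coefficients does no harm because
  \<open>R\<close> can be chosen as large as needed; a category argument would only give an interval whose
  length depends on \<open>R\<close>, and the loss would then depend on \<open>R\<close> as well.
\<close>

lemma letter_sum_bound:
  assumes f: "f \<in> H1" and \<rho>: "\<rho> > 0"
  obtains M where "M \<ge> 0" "\<And>d n. norm (letter_sum x f d n) * \<rho> ^ d \<le> M"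
proof -
  define B :: real where "B = 16 * exp 4"
  \<comment> \<open>\<open>B\<close> is the base of the exponential loss.\<close>
  define R where "R = B * \<rho>"
  have B: "B > 0" and R: "R > 0" using \<rho> by (simp_all add: B_def R_def)
  define P where "P d t = (\<Sum>n\<le>d. t ^ n *\<^sub>R letter_sum x f d n)" for d and t :: real
  have hom: "norm (hom_part (marked_point x R t) f d) = R ^ d * norm (P d t)" for d t
    using R by (simp add: hom_part_marked_point P_def)
  define E where "E m = {t \<in> {0..1}. \<forall>d. R ^ d * norm (P d t) \<le> real m}" for m
  have "closed (E m)" for m
  proof -
    have "E m = {0..1} \<inter> (\<Inter>d. {t. R ^ d * norm (P d t) \<le> real m})"
      by (auto simp: E_def)
    moreover have "closed {t. R ^ d * norm (P d t) \<le> real m}" for d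
      unfolding P_def by (intro closed_Collect_le continuous_intros)
    ultimately show ?thesis by (auto intro!: closed_Int closed_INT)
  qed
  then have E: "E m \<in> sets lborel" for m by simp
  have E_sub: "E m \<subseteq> {0..1}" for m by (auto simp: E_def)
  have "E k \<subseteq> E m" if "k \<le> m" for k m
  proof
    fix t assume t: "t \<in> E k"
    then have "R ^ d * norm (P d t) \<le> real k" for d by (simp add: E_def)
    moreover have "real k \<le> real m" using that by simp
    ultimately have "R ^ d * norm (P d t) \<le> real m" for d by (rule order_trans)
    with t show "t \<in> E m" by (simp add: E_def)
  qed
  then have "incseq E" by (intro monoI)
  have "(\<Union>m. E m) = {0..1}"
  proof (intro antisym subsetI)
    fix t :: real assume t: "t \<in> {0..1}"
    obtain M where "\<And>d. R ^ d * norm (P d t) \<le> M"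
      using H1_marked_point_bounded[OF f, of x R t] hom by metis
    then have "t \<in> E (nat \<lceil>M\<rceil>)"
      using t unfolding E_def by (auto intro: order_trans[OF _ of_nat_ceiling])
    then show "t \<in> (\<Union>m. E m)" by blast
  qed (auto simp: E_def)
  then have "(\<lambda>m. measure lborel (E m)) \<longlonglongrightarrow> 1"
    using Lim_measure_incseq[of E lborel] E \<open>incseq E\<close> by auto
  then have "\<forall>\<^sub>F m in sequentially. 1 / 2 < measure lborel (E m)"
    by (rule order_tendstoD) simp
  then obtain m where m: "1 / 2 \<le> measure lborel (E m)"
    by (metis eventually_sequentially less_imp_le order_refl)
  show thesis
  proof
    show "B * real m \<ge> 0" using B by simp
    show "norm (letter_sum x f d n) * \<rho> ^ d \<le> B * real m" for d n
    proof (cases "n \<le> d")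
      case True
      have "norm (P d t) \<le> real m / R ^ d" if "t \<in> E m" for t
        using that R by (simp add: E_def field_simps)
      then have "norm (letter_sum x f d n) \<le> B ^ Suc d * (real m / R ^ d)"
        using coefficient_bound_on_large_set[OF E[of m] _ m _ True, of "letter_sum x f d"] E_sub
        unfolding P_def B_def by blast
      also have "\<dots> = B * real m / \<rho> ^ d"
        using B by (simp add: R_def power_mult_distrib)
      finally show ?thesis using \<rho> by (simp add: field_simps)
    next
      case False
      have "letter_sum x f d n = 0"
        unfolding letter_sum_def using False count_le_length[of _ x] by (intro sum.neutral) auto
      then show ?thesis using B by simp
    qed
  qed
qed

text \<open>
  Double counting of the pairs of a word \<open>s\<close> with \<open>n + 1\<close> letters \<open>x\<close> and a position of \<open>x\<close> in \<open>s\<close>: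
  deleting the letter at that position gives the pairs on the left.
\<close>

lemma sum_insert_letter:
  fixes f :: "'a::finite series"
  shows "(\<Sum>v | length v = d \<and> count_list v x = n. \<Sum>i\<le>d. f (take i v @ x # drop i v))
    = of_nat (Suc n) * letter_sum x f (Suc d) (Suc n)"
proof -
  let ?V = "\<lambda>d n. {v. length v = d \<and> count_list v x = n}"
  have fin: "finite (?V d n)" for d n
    by (rule finite_subset[OF _ finite_words[of d]]) auto
  have occ: "card {i. i < Suc d \<and> s ! i = x} = Suc n"
    if "length s = Suc d" "count_list s x = Suc n" for s
    using that by (simp add: count_list_eq_length_filter length_filter_conv_card eq_commute)
  have "(\<Sum>v\<in>?V d n. \<Sum>i\<le>d. f (take i v @ x # drop i v))
      = (\<Sum>(v, i)\<in>?V d n \<times> {..d}. f (take i v @ x # drop i v))"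
    by (simp add: sum.cartesian_product)
  also have "\<dots> = (\<Sum>(s, i)\<in>(SIGMA s:?V (Suc d) (Suc n). {i. i < length s \<and> s ! i = x}). f s)"
  proof (rule sum.reindex_bij_witness[of _ "\<lambda>(s, i). (take i s @ drop (Suc i) s, i)"
        "\<lambda>(v, i). (take i v @ x # drop i v, i)"])
    fix a assume "a \<in> ?V d n \<times> {..d}"
    then obtain v i where a: "a = (v, i)" "length v = d" "count_list v x = n" "i \<le> d" by auto
    have "count_list (take i v) x + count_list (drop i v) x = n"
      using a by (metis append_take_drop_id count_list_append)
    with a show "(case a of (v, i) \<Rightarrow> (take i v @ x # drop i v, i))
        \<in> (SIGMA s:?V (Suc d) (Suc n). {i. i < length s \<and> s ! i = x})"
      by (auto simp: nth_append)
    show "(case case a of (v, i) \<Rightarrow> (take i v @ x # drop i v, i) of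
        (s, i) \<Rightarrow> (take i s @ drop (Suc i) s, i)) = a"
      using a by simp
    show "(case case a of (v, i) \<Rightarrow> (take i v @ x # drop i v, i) of (s, i) \<Rightarrow> f s)
        = (case a of (v, i) \<Rightarrow> f (take i v @ x # drop i v))"
      using a by simp
  next
    fix b assume "b \<in> (SIGMA s:?V (Suc d) (Suc n). {i. i < length s \<and> s ! i = x})"
    then obtain s i where b: "b = (s, i)" "length s = Suc d" "count_list s x = Suc n"
      "i < length s" "s ! i = x" by (elim SigmaE CollectE conjE) blast
    have s: "s = take i s @ x # drop (Suc i) s"
      using b by (metis id_take_nth_drop)
    then have "Suc n = count_list (take i s) x + Suc (count_list (drop (Suc i) s) x)"
      using b by (metis count_list.simps(2) count_list_append Suc_eq_plus1)
    with b show "(case b of (s, i) \<Rightarrow> (take i s @ drop (Suc i) s, i)) \<in> ?V d n \<times> {..d}"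
      by auto
    show "(case case b of (s, i) \<Rightarrow> (take i s @ drop (Suc i) s, i) of
        (v, i) \<Rightarrow> (take i v @ x # drop i v, i)) = b"
      using b by (simp add: s[symmetric])
  qed
  also have "\<dots> = (\<Sum>s\<in>?V (Suc d) (Suc n). \<Sum>i | i < length s \<and> s ! i = x. f s)"
    by (subst sum.Sigma) (auto simp: fin)
  also have "\<dots> = of_nat (Suc n) * letter_sum x f (Suc d) (Suc n)"
    unfolding letter_sum_def sum_distrib_left by (intro sum.cong refl) (simp add: occ)
  finally show ?thesis .
qed

section \<open>The rotor\<close>

text \<open>
  There are \<open>2^d\<close> words of length \<open>d\<close>, so any rate of decay above \<open>2 max(|z|, |w|)\<close> suffices at the
  point \<open>(z, w)\<close>.
\<close>

lemma H1_if_coefficients_decay: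
  assumes decay: "\<And>\<rho>. \<rho> > 0 \<Longrightarrow> \<exists>M. \<forall>v. norm (r v) * \<rho> ^ length v \<le> M"
  shows "r \<in> H1"
  unfolding H1_def
proof (intro CollectI allI)
  fix z w :: quat
  let ?e = "case_zw z w"
  define m where "m = 1 + norm z + norm w"
  have m: "m > 0" unfolding m_def by (simp add: add_pos_nonneg)
  have "norm (?e y) \<le> m" for y
    by (cases y) (simp_all add: m_def)
  then have e: "norm (prod_list (map ?e v)) \<le> m ^ length v" for v
    by (induction v) (use m in \<open>auto simp: norm_mult intro!: mult_mono\<close>)
  obtain M where M: "\<And>v. norm (r v) * (4 * m) ^ length v \<le> M"
    using decay[of "4 * m"] m by auto
  have "norm (hom_part ?e r d) \<le> M * (1 / 2) ^ d" for d
  proof -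
    have "norm (hom_part ?e r d) \<le> (\<Sum>v :: zw list | length v = d. M / 4 ^ d)"
      unfolding hom_part_def
    proof (rule sum_norm_le)
      fix v :: "zw list" assume "v \<in> {v. length v = d}"
      then have "norm (prod_list (map ?e v) * r v) \<le> m ^ d * (M / (4 * m) ^ d)"
        unfolding norm_mult using e[of v] M[of v] m by (intro mult_mono) (auto simp: field_simps)
      also have "\<dots> = M / 4 ^ d" using m by (simp add: power_mult_distrib)
      finally show "norm (prod_list (map ?e v) * r v) \<le> M / 4 ^ d" .
    qed
    also have "card {v :: zw list. length v = d} = 2 ^ d"
    proof -
      have "card (UNIV :: zw set) = 2" by (simp add: UNIV_zw)
      then show ?thesis using card_lists_length_eq[of "UNIV :: zw set" d] by simp
    qed
    then have "(\<Sum>v :: zw list | length v = d. M / 4 ^ d) = 2 ^ d * (M / 4 ^ d)" by simp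
    also have "\<dots> = M * (2 / 4) ^ d" by (simp only: power_divide) simp
    finally show ?thesis by simp
  qed
  moreover have "summable (\<lambda>d. M * (1 / 2) ^ d)"
    by (intro summable_mult summable_geometric) simp
  ultimately show "summable (\<lambda>d. norm (hom_part ?e r d))"
    using summable_comparison_test'[of _ 0 "\<lambda>d. norm (hom_part ?e r d)"] by (metis abs_norm_cancel real_norm_def)
qed

lemma pd_hat_single_H: "pd_hat x k (map Var u @ H # map Var v) = k (u @ x # v)"
proof -
  have "count_list (map Var v) H = 0" for v
    by (induction v) auto
  then show ?thesis by (simp add: pd_hat_def o_def)
qed

text \<open>
  A series \<open>h r(z, w)\<close> contains only words that begin with \<open>h\<close>. Hence the components of the field
  are tied to each other at all positions behind the first letter, and the rotor measures
  the defect of this relation at the first letter.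
\<close>

lemma rotor_coefficients:
  assumes "Rot (f, g) = h_times r"
  shows "f (u @ W # v) - g (u @ Z # v) = (if u = [] then r v else 0)"
proof -
  let ?w = "map Var u @ H # map Var v"
  have "Rot (f, g) ?w = f (u @ W # v) - g (u @ Z # v)"
    by (simp add: Rot_def pd_hat_single_H)
  moreover have "h_times r ?w = (if u = [] then r v else 0)"
    by (cases u) (auto simp: h_times_def o_def)
  ultimately show ?thesis using assms by simp
qed

text \<open>
  Behind the first letter \<open>w\<close> of \<open>f\<close> one may trade \<open>w\<close> for \<open>z\<close> at the cost of passing to \<open>g\<close>. Both
  \<open>f(w u z w v)\<close> and \<open>f(w u w z v)\<close> become \<open>g(w u z z v)\<close>, and likewise for the two coefficients
  of \<open>g\<close> with first letter \<open>z\<close>.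
\<close>

lemma rotor_swap_invariant:
  assumes "Rot (f, g) = h_times r"
  shows "r (u @ Z # W # v) = r (u @ W # Z # v)"
proof -
  note c = rotor_coefficients[OF assms]
  show ?thesis
    using c[of "[]" "u @ Z # W # v"] c[of "[]" "u @ W # Z # v"]
      c[of "W # u" "Z # v"] c[of "W # u @ [Z]" v] c[of "Z # u" "W # v"] c[of "Z # u @ [W]" v]
    by simp
qed

text \<open>
  Quaternions satisfy polynomial identities, so the values of a series of words do not determine
  its coefficients, and convergence of \<open>f\<close> and \<open>g\<close> does not in general bound the coefficient of a
  single word. But all words of one bidegree have the same coefficient in the rotor. Summing the
  identity \<open>r(v) = \<Sum>\<^sub>i f(v with w inserted at i) - g(v with z inserted at i)\<close> over all words \<open>v\<close> of
  this bidegree leaves on the right only the sums over bidegrees of \<open>f\<close> and \<open>g\<close>, and these do decay.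
\<close>

lemma rotor_in_H1:
  assumes f: "f \<in> H1" and g: "g \<in> H1" and r: "Rot (f, g) = h_times r"
  shows "r \<in> H1"
proof (rule H1_if_coefficients_decay)
  fix \<rho> :: real assume \<rho>: "\<rho> > 0"
  then have "2 * \<rho> > 0" by simp
  obtain M1 where M1: "\<And>d n. norm (letter_sum W f d n) * (2 * \<rho>) ^ d \<le> M1"
    using letter_sum_bound[OF f \<open>2 * \<rho> > 0\<close>] by blast
  obtain M2 where M2: "\<And>d n. norm (letter_sum Z g d n) * (2 * \<rho>) ^ d \<le> M2"
    using letter_sum_bound[OF g \<open>2 * \<rho> > 0\<close>] by blast
  have "norm (r v) * \<rho> ^ length v \<le> (M1 + M2) / \<rho>" for v
  proof -
    define d p q where "d = length v" and "p = count_list v Z" and "q = count_list v W"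
    have pq: "p + q = d" unfolding d_def p_def q_def by (rule length_eq_counts)
    let ?V = "{u. length u = d \<and> count_list u W = q}"
    have fin: "finite ?V" by (rule finite_subset[OF _ finite_words[of d]]) auto
    have V_Z: "?V = {u. length u = d \<and> count_list u Z = p}"
      using length_eq_counts pq by (metis add_left_cancel add_right_cancel)
    have const: "r u = r v" if "u \<in> ?V" for u
    proof -
      have "count_list u Z = p" "count_list u W = q" using that V_Z by auto
      then show ?thesis
        using swap_invariant_sort[of r, OF rotor_swap_invariant[OF r]] unfolding p_def q_def by metis
    qed
    have ins: "(\<Sum>i\<le>d. f (take i u @ W # drop i u)) - (\<Sum>i\<le>d. g (take i u @ Z # drop i u)) = r v"
      if "u \<in> ?V" for u
    proof -
      have "f (take i u @ W # drop i u) - g (take i u @ Z # drop i u) = (if i = 0 then r u else 0)"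
        if "i \<le> d" for i
        using that \<open>u \<in> ?V\<close> rotor_coefficients[OF r, of "take i u" "drop i u"] by auto
      then have "(\<Sum>i\<le>d. f (take i u @ W # drop i u) - g (take i u @ Z # drop i u))
          = (\<Sum>i\<le>d. if i = 0 then r u else 0)"
        by (intro sum.cong) auto
      then show ?thesis using const[OF that] by (simp add: sum_subtractf)
    qed
    have "of_nat (card ?V) * r v = (\<Sum>u\<in>?V. (\<Sum>i\<le>d. f (take i u @ W # drop i u))
        - (\<Sum>i\<le>d. g (take i u @ Z # drop i u)))"
      using ins by simp
    also have "\<dots> = of_nat (Suc q) * letter_sum W f (Suc d) (Suc q)
        - of_nat (Suc p) * letter_sum Z g (Suc d) (Suc p)"
      unfolding sum_subtractf sum_insert_letter by (subst V_Z) (simp only: sum_insert_letter)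
    finally have eq: "of_nat (card ?V) * r v = of_nat (Suc q) * letter_sum W f (Suc d) (Suc q)
        - of_nat (Suc p) * letter_sum Z g (Suc d) (Suc p)" .
    \<comment> \<open>The factor \<open>card ?V\<close> is a positive integer and can be dropped from an upper bound for \<open>r v\<close>.\<close>
    have "v \<in> ?V" by (simp add: d_def q_def)
    then have "card ?V \<ge> 1" using fin by (metis card_gt_0_iff empty_iff less_one linorder_not_le not_gr0)
    then have "norm (r v) \<le> real (card ?V) * norm (r v)"
      using mult_right_mono[of 1 "real (card ?V)" "norm (r v)"] by simp
    also have "\<dots> = norm (of_nat (card ?V) * r v)" by (simp add: norm_mult)
    also have "\<dots> \<le> real (Suc q) * norm (letter_sum W f (Suc d) (Suc q))
        + real (Suc p) * norm (letter_sum Z g (Suc d) (Suc p))"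
      unfolding eq by (rule order_trans[OF norm_triangle_ineq4]) (simp only: norm_mult norm_of_nat order_refl)
    also have "\<dots> \<le> real (Suc d) * (M1 / (2 * \<rho>) ^ Suc d) + real (Suc d) * (M2 / (2 * \<rho>) ^ Suc d)"
    proof (intro add_mono mult_mono)
      show "norm (letter_sum W f (Suc d) (Suc q)) \<le> M1 / (2 * \<rho>) ^ Suc d"
        using M1[of "Suc d" "Suc q"] \<rho> by (subst pos_le_divide_eq) auto
      show "norm (letter_sum Z g (Suc d) (Suc p)) \<le> M2 / (2 * \<rho>) ^ Suc d"
        using M2[of "Suc d" "Suc p"] \<rho> by (subst pos_le_divide_eq) auto
    qed (use pq in auto)
    also have "\<dots> = real (Suc d) / 2 ^ Suc d * ((M1 + M2) / \<rho> ^ Suc d)"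
    proof -
      have "X * (M1 / (2 * \<rho>) ^ k) + X * (M2 / (2 * \<rho>) ^ k) = X / 2 ^ k * ((M1 + M2) / \<rho> ^ k)"
        for X k by (simp add: power_mult_distrib add_divide_distrib distrib_left)
      then show ?thesis .
    qed
    also have "\<dots> \<le> 1 * ((M1 + M2) / \<rho> ^ Suc d)"
    proof (rule mult_right_mono)
      show "real (Suc d) / 2 ^ Suc d \<le> 1"
        using of_nat_less_two_power[of "Suc d", where 'a = real] by (simp add: field_simps)
      have "0 \<le> M1 + M2"
        using order_trans[OF _ M1[of 0 0]] order_trans[OF _ M2[of 0 0]] by (simp add: add_nonneg_nonneg)
      then show "0 \<le> (M1 + M2) / \<rho> ^ Suc d" using \<rho> by simp
    qed
    finally show ?thesis using \<rho> by (simp add: field_simps d_def)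
  qed
  then show "\<exists>M. \<forall>v. norm (r v) * \<rho> ^ length v \<le> M" by blast
qed

section \<open>Fields with vanishing rotor\<close>

text \<open>
  The coefficients of a potential as forced by Euler's relation \<open>d \<chi>\<^sub>d = z f\<^bsub>d-1\<^esub> + w g\<^bsub>d-1\<^esub>\<close> between
  its homogeneous parts and those of the two components.
\<close>

definition potential :: "zw series \<Rightarrow> zw series \<Rightarrow> quat \<Rightarrow> zw series" where
  "potential f g C = (\<lambda>v. case v of [] \<Rightarrow> C
     | x # s \<Rightarrow> (case x of Z \<Rightarrow> f s | W \<Rightarrow> g s) / of_nat (length v))"

text \<open>
  In this form convergence needs no information on coefficients: the part of degree \<open>d + 1\<close> is a
  combination of the parts of degree \<open>d\<close> of \<open>f\<close> and \<open>g\<close> with multipliers \<open>z / (d + 1)\<close> and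
  \<open>w / (d + 1)\<close>.
\<close>

lemma potential_in_H1:
  assumes f: "f \<in> H1" and g: "g \<in> H1"
  shows "potential f g C \<in> H1"
  unfolding H1_def
proof (intro CollectI allI)
  fix z w :: quat
  let ?e = "case_zw z w"
  have "hom_part ?e (\<lambda>s. k s / of_nat (Suc (length s))) d = hom_part ?e k d / of_nat (Suc d)"
    for k :: "zw series" and d
    unfolding hom_part_def divide_inverse sum_distrib_right
    by (intro sum.cong refl) (simp add: mult.assoc)
  then have hom: "hom_part ?e (potential f g C) (Suc d)
      = z * (hom_part ?e f d / of_nat (Suc d)) + w * (hom_part ?e g d / of_nat (Suc d))" for d
    by (simp add: hom_part_Suc UNIV_zw potential_def)
  have small: "norm (a / of_nat (Suc d)) \<le> norm a" for a :: quat and d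
  proof -
    have "norm (a / of_nat (Suc d)) = norm a / real (Suc d)"
      by (simp only: divide_inverse norm_mult norm_inverse norm_of_nat)
    also have "\<dots> \<le> norm a / 1" by (intro divide_left_mono) auto
    finally show ?thesis by simp
  qed
  have bound: "norm (hom_part ?e (potential f g C) (Suc d))
      \<le> norm z * norm (hom_part ?e f d) + norm w * norm (hom_part ?e g d)" for d
    unfolding hom
    by (rule order_trans[OF norm_triangle_ineq])
      (auto simp only: norm_mult intro!: add_mono mult_left_mono small norm_ge_zero)
  have major: "summable (\<lambda>d. norm z * norm (hom_part ?e f d) + norm w * norm (hom_part ?e g d))"
    using f g unfolding H1_def by (intro summable_add summable_mult) blast+
  have "summable (\<lambda>d. norm (hom_part ?e (potential f g C) (Suc d)))"
    by (intro summable_norm_comparison_test[OF _ major] exI[of _ 0] allI impI bound)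
  then show "summable (\<lambda>d. norm (hom_part ?e (potential f g C) d))"
    using summable_Suc_iff[of "\<lambda>d. norm (hom_part ?e (potential f g C) d)"] by blast
qed

lemma pd_tilde_eq: "pd_tilde x k v = (\<Sum>i\<le>length v. k (take i v @ x # drop i v))"
  by (simp only: pd_tilde_def at_one_def pd_hat_single_H)

lemma curl_free_swap_invariant:
  assumes rot: "\<And>u v. f (u @ W # v) = g (u @ Z # v)"
  shows curl_free_swap_fst: "f (u @ Z # W # v) = f (u @ W # Z # v)"
    and curl_free_swap_snd: "g (u @ Z # W # v) = g (u @ W # Z # v)"
  using rot[of "u @ [Z]" v] rot[of u "Z # v"] rot[of u "W # v"] rot[of "u @ [W]" v] by simp_all

lemma curl_free_normal_word:
  assumes rot: "\<And>u v. f (u @ W # v) = g (u @ Z # v)"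
  shows "f (normal_word p (Suc q)) = g (normal_word (Suc p) q)"
  using rot[of "replicate p Z" "replicate q W"]
  by (simp add: normal_word_def replicate_app_Cons_same)

text \<open>
  The potential of a field without rotor depends on the bidegree only, so a letter may be moved to
  the front, where the definition of the potential can be applied.
\<close>

lemma curl_free_insert:
  assumes rot: "\<And>u v. f (u @ W # v) = g (u @ Z # v)"
  shows "potential f g C (u @ Z # v) = f (u @ v) / of_nat (Suc (length (u @ v)))"
    and "potential f g C (u @ W # v) = g (u @ v) / of_nat (Suc (length (u @ v)))"
proof -
  note sf = swap_invariant_sort[of f, OF curl_free_swap_fst[of f g, OF rot]]
    and sg = swap_invariant_sort[of g, OF curl_free_swap_snd[of f g, OF rot]]
  have "f (s @ Z # v) = f (Z # s @ v)" "g (s @ W # v) = g (W # s @ v)" for s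
    using sf[of "s @ Z # v"] sf[of "Z # s @ v"] sg[of "s @ W # v"] sg[of "W # s @ v"] by simp_all
  moreover have "g (s @ Z # v) = f (W # s @ v)" "f (s @ W # v) = g (Z # s @ v)" for s
    using rot[of s v] rot[of "[]" "s @ v"] sf[of "s @ W # v"] sf[of "W # s @ v"] by simp_all
  ultimately have "potential f g C (u @ Z # v) = f (u @ v) / of_nat (Suc (length (u @ v)))
    \<and> potential f g C (u @ W # v) = g (u @ v) / of_nat (Suc (length (u @ v)))"
    by (cases u) (auto simp: potential_def split: zw.split)
  then show "potential f g C (u @ Z # v) = f (u @ v) / of_nat (Suc (length (u @ v)))"
    "potential f g C (u @ W # v) = g (u @ v) / of_nat (Suc (length (u @ v)))" by auto
qed

text \<open>
  All \<open>d + 1\<close> ways to insert a letter into a word of length \<open>d\<close> give the same coefficient of the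
  potential, which cancels the denominator \<open>d + 1\<close>.
\<close>

lemma pd_tilde_potential:
  assumes rot: "\<And>u v. f (u @ W # v) = g (u @ Z # v)"
  shows "pd_tilde Z (potential f g C) = f" and "pd_tilde W (potential f g C) = g"
proof -
  have cancel: "of_nat (Suc n) * a / of_nat (Suc n) = a" for a :: quat and n
    by (simp only: mult_of_nat_commute[of "Suc n" a]) (simp add: divide_inverse mult.assoc del: of_nat_Suc)
  show "pd_tilde Z (potential f g C) = f" "pd_tilde W (potential f g C) = g"
    by (rule ext, simp add: pd_tilde_eq curl_free_insert[of f g, OF rot] cancel del: of_nat_Suc)+
qed

text \<open>
  The coefficient \<open>a p q\<close> is the one of \<open>f\<close> in bidegree \<open>(p - 1, q)\<close>, and by the vanishing of the
  rotor also the one of \<open>g\<close> in bidegree \<open>(p, q - 1)\<close>. What is left over are the powers of \<open>z\<close> in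
  \<open>f\<close> and the powers of \<open>w\<close> in \<open>g\<close>, which have no partner in the other component.
\<close>

lemma curl_free_expansion:
  assumes rot: "\<And>u v. f (u @ W # v) = g (u @ Z # v)"
  defines "a \<equiv> \<lambda>p q. f (normal_word (p - 1) q)"
  shows "f = series_sum (\<lambda>(p, q). S (p - 1) q \<odot> a p q) {(p, q). p \<ge> 1 \<and> q \<ge> 1}
             + series_sum (\<lambda>p. mono_word (replicate p Z) \<odot> f (normal_word p 0)) UNIV" (is ?F)
    and "g = series_sum (\<lambda>(p, q). S p (q - 1) \<odot> a p q) {(p, q). p \<ge> 1 \<and> q \<ge> 1}
             + series_sum (\<lambda>q. mono_word (replicate q W) \<odot> g (normal_word 0 q)) UNIV" (is ?G)
    and "potential f g C =
        series_sum (\<lambda>(p, q). S p q \<odot> (a p q / of_nat (p + q))) {(p, q). p \<ge> 1 \<and> q \<ge> 1}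
        + series_sum (\<lambda>p. mono_word (replicate (p + 1) Z) \<odot> (f (normal_word p 0) / of_nat (p + 1))
                        + mono_word (replicate (p + 1) W) \<odot> (g (normal_word 0 p) / of_nat (p + 1))) UNIV
        + mono_word [] \<odot> C" (is ?P)
proof -
  note sf = swap_invariant_sort[of f, OF curl_free_swap_fst[of f g, OF rot]]
    and sg = swap_invariant_sort[of g, OF curl_free_swap_snd[of f g, OF rot]]
  note coeffs = S_def rmult_def mono_word_replicate
  show ?F
  proof
    fix v
    have "series_sum (\<lambda>(p, q). S (p - 1) q \<odot> a p q) {(p, q). p \<ge> 1 \<and> q \<ge> 1} v
        = (if count_list v W = 0 then 0 else f v)"
      by (subst series_sum_single[where k = "(Suc (count_list v Z), count_list v W)"])
        (auto simp: coeffs a_def sf[of v] split: if_splits)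
    moreover have "series_sum (\<lambda>p. mono_word (replicate p Z) \<odot> f (normal_word p 0)) UNIV v
        = (if count_list v W = 0 then f v else 0)"
      by (subst series_sum_single[where k = "count_list v Z"])
        (auto simp: coeffs sf[of v] split: if_splits)
    ultimately show "f v = (series_sum (\<lambda>(p, q). S (p - 1) q \<odot> a p q) {(p, q). p \<ge> 1 \<and> q \<ge> 1}
             + series_sum (\<lambda>p. mono_word (replicate p Z) \<odot> f (normal_word p 0)) UNIV) v" by simp
  qed
  show ?G
  proof
    fix v
    have "series_sum (\<lambda>(p, q). S p (q - 1) \<odot> a p q) {(p, q). p \<ge> 1 \<and> q \<ge> 1} v
        = (if count_list v Z = 0 then 0 else g v)"
      by (subst series_sum_single[where k = "(count_list v Z, Suc (count_list v W))"])
        (auto simp: coeffs a_def curl_free_normal_word[of f g, OF rot] sg[of v] split: if_splits)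
    moreover have "series_sum (\<lambda>q. mono_word (replicate q W) \<odot> g (normal_word 0 q)) UNIV v
        = (if count_list v Z = 0 then g v else 0)"
      by (subst series_sum_single[where k = "count_list v W"])
        (auto simp: coeffs sg[of v] split: if_splits)
    ultimately show "g v = (series_sum (\<lambda>(p, q). S p (q - 1) \<odot> a p q) {(p, q). p \<ge> 1 \<and> q \<ge> 1}
             + series_sum (\<lambda>q. mono_word (replicate q W) \<odot> g (normal_word 0 q)) UNIV) v" by simp
  qed
  show ?P
  proof
    fix v
    let ?p = "count_list v Z" and ?q = "count_list v W"
    have mixed: "series_sum (\<lambda>(p, q). S p q \<odot> (a p q / of_nat (p + q))) {(p, q). p \<ge> 1 \<and> q \<ge> 1} v
        = (if ?p \<ge> 1 \<and> ?q \<ge> 1 then a ?p ?q / of_nat (length v) else 0)"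
      by (subst series_sum_single[where k = "(?p, ?q)"])
        (auto simp: coeffs length_eq_counts simp del: of_nat_add split: if_splits)
    have pure: "series_sum (\<lambda>p. mono_word (replicate (p + 1) Z) \<odot> (f (normal_word p 0) / of_nat (p + 1))
                + mono_word (replicate (p + 1) W) \<odot> (g (normal_word 0 p) / of_nat (p + 1))) UNIV v
        = (if ?p \<ge> 1 \<and> ?q = 0 then f (normal_word (?p - 1) 0) / of_nat (length v) else 0)
        + (if ?p = 0 \<and> ?q \<ge> 1 then g (normal_word 0 (?q - 1)) / of_nat (length v) else 0)"
    proof -
      have pure_word: "(mono_word (replicate (p + 1) Z) \<odot> x + mono_word (replicate (p + 1) W) \<odot> y) v
          = (if ?p = p + 1 \<and> ?q = 0 then x else 0) + (if ?p = 0 \<and> ?q = p + 1 then y else 0)" for p x y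
        unfolding mono_word_replicate by (simp add: S_def rmult_def)
      show ?thesis
      \<comment> \<open>For the empty word \<open>length v - 1\<close> is \<open>0\<close>, and the member \<open>0\<close> of the family vanishes there.\<close>
      proof (subst series_sum_single[where k = "length v - 1"], goal_cases)
        case (1 p)
        then show ?case
          unfolding pure_word using length_eq_counts[of v] by auto
      next
        case 2
        show ?case
          unfolding pure_word using length_eq_counts[of v] by auto
      qed
    qed
    have const: "(mono_word [] \<odot> C) v = (if ?p = 0 \<and> ?q = 0 then C else 0)"
      using length_eq_counts[of v] by (auto simp: mono_word_def rmult_def)
    have "potential f g C v = (if ?p \<ge> 1 \<and> ?q \<ge> 1 then a ?p ?q / of_nat (length v) else 0)
        + ((if ?p \<ge> 1 \<and> ?q = 0 then f (normal_word (?p - 1) 0) / of_nat (length v) else 0)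
        + (if ?p = 0 \<and> ?q \<ge> 1 then g (normal_word 0 (?q - 1)) / of_nat (length v) else 0))
        + (if ?p = 0 \<and> ?q = 0 then C else 0)"
    proof (cases v)
      case (Cons y s)
      show ?thesis
      proof (cases y)
        case Z
        then show ?thesis using Cons sf[of s] by (auto simp: potential_def a_def)
      next
        case W
        have "f (normal_word (p - 1) (Suc q)) = g (normal_word p q)" if "p \<ge> 1" for p q
          using that curl_free_normal_word[of f g "p - 1" q, OF rot] by simp
        then show ?thesis using Cons W sg[of s] by (auto simp: potential_def a_def)
      qed
    qed (simp add: potential_def)
    then show "potential f g C v =
       (series_sum (\<lambda>(p, q). S p q \<odot> (a p q / of_nat (p + q))) {(p, q). p \<ge> 1 \<and> q \<ge> 1}
        + series_sum (\<lambda>p. mono_word (replicate (p + 1) Z) \<odot> (f (normal_word p 0) / of_nat (p + 1))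
                        + mono_word (replicate (p + 1) W) \<odot> (g (normal_word 0 p) / of_nat (p + 1))) UNIV
        + mono_word [] \<odot> C) v"
      by (simp only: plus_fun_apply mixed pure const)
  qed
qed

theorem theorem3p7:
  fixes X :: vector_field and f g :: "zw series"
  assumes "X = (f, g)" and "X \<in> VH1" and "has_rotor X"
  shows "bidegree_full (rot X) \<and>
    (rot X = 0 \<longrightarrow>
      bidegree_full_vf X \<and>
      (\<exists>(a :: nat \<Rightarrow> nat \<Rightarrow> quat) (b :: nat \<Rightarrow> quat) (c :: nat \<Rightarrow> quat).
        X = (series_sum (\<lambda>(p, q). S (p - 1) q \<odot> a p q) {(p, q). p \<ge> 1 \<and> q \<ge> 1},
             series_sum (\<lambda>(p, q). S p (q - 1) \<odot> a p q) {(p, q). p \<ge> 1 \<and> q \<ge> 1})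
          + (series_sum (\<lambda>p. mono_word (replicate p Z) \<odot> b p) UNIV,
             series_sum (\<lambda>q. mono_word (replicate q W) \<odot> c q) UNIV) \<and>
        (\<forall>C :: quat. let chi =
            series_sum (\<lambda>(p, q). S p q \<odot> (a p q / of_nat (p + q))) {(p, q). p \<ge> 1 \<and> q \<ge> 1}
            + series_sum (\<lambda>p. mono_word (replicate (p + 1) Z) \<odot> (b p / of_nat (p + 1))
                            + mono_word (replicate (p + 1) W) \<odot> (c p / of_nat (p + 1))) UNIV
            + mono_word [] \<odot> C in
          chi \<in> H1 \<and> X = (pd_tilde Z chi, pd_tilde W chi))))"
proof (intro conjI impI)
  have f: "f \<in> H1" and g: "g \<in> H1"
    using assms by (simp_all add: VH1_def)
  have r: "Rot (f, g) = h_times (rot X)"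
    using Rot_eq[OF assms(3)] assms(1) by simp
  show "bidegree_full (rot X)"
    by (rule bidegree_fullI[OF rotor_swap_invariant[OF r] rotor_in_H1[OF f g r]])
  assume "rot X = 0"
  then have rot: "f (u @ W # v) = g (u @ Z # v)" for u v
    using rotor_coefficients[OF r, of u v] by (simp split: if_splits)
  show "bidegree_full_vf X"
    using bidegree_fullI[OF curl_free_swap_fst[of f g, OF rot] f] bidegree_fullI[OF curl_free_swap_snd[of f g, OF rot] g]
    by (simp add: bidegree_full_vf_def assms(1))
  note expansion = curl_free_expansion[of f g, OF rot]
  show "\<exists>(a :: nat \<Rightarrow> nat \<Rightarrow> quat) (b :: nat \<Rightarrow> quat) (c :: nat \<Rightarrow> quat).
        X = (series_sum (\<lambda>(p, q). S (p - 1) q \<odot> a p q) {(p, q). p \<ge> 1 \<and> q \<ge> 1},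
             series_sum (\<lambda>(p, q). S p (q - 1) \<odot> a p q) {(p, q). p \<ge> 1 \<and> q \<ge> 1})
          + (series_sum (\<lambda>p. mono_word (replicate p Z) \<odot> b p) UNIV,
             series_sum (\<lambda>q. mono_word (replicate q W) \<odot> c q) UNIV) \<and>
        (\<forall>C :: quat. let chi =
            series_sum (\<lambda>(p, q). S p q \<odot> (a p q / of_nat (p + q))) {(p, q). p \<ge> 1 \<and> q \<ge> 1}
            + series_sum (\<lambda>p. mono_word (replicate (p + 1) Z) \<odot> (b p / of_nat (p + 1))
                            + mono_word (replicate (p + 1) W) \<odot> (c p / of_nat (p + 1))) UNIV
            + mono_word [] \<odot> C in
          chi \<in> H1 \<and> X = (pd_tilde Z chi, pd_tilde W chi))"
  proof (intro exI conjI allI)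
    show "X = (series_sum (\<lambda>(p, q). S (p - 1) q \<odot> f (normal_word (p - 1) q)) {(p, q). p \<ge> 1 \<and> q \<ge> 1},
             series_sum (\<lambda>(p, q). S p (q - 1) \<odot> f (normal_word (p - 1) q)) {(p, q). p \<ge> 1 \<and> q \<ge> 1})
          + (series_sum (\<lambda>p. mono_word (replicate p Z) \<odot> f (normal_word p 0)) UNIV,
             series_sum (\<lambda>q. mono_word (replicate q W) \<odot> g (normal_word 0 q)) UNIV)"
      unfolding assms(1) plus_prod_def fst_conv snd_conv prod.inject
      by (intro conjI expansion(1,2))
    fix C :: quat
    show "let chi =
            series_sum (\<lambda>(p, q). S p q \<odot> (f (normal_word (p - 1) q) / of_nat (p + q))) {(p, q). p \<ge> 1 \<and> q \<ge> 1}
            + series_sum (\<lambda>p. mono_word (replicate (p + 1) Z) \<odot> (f (normal_word p 0) / of_nat (p + 1))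
                            + mono_word (replicate (p + 1) W) \<odot> (g (normal_word 0 p) / of_nat (p + 1))) UNIV
            + mono_word [] \<odot> C in
          chi \<in> H1 \<and> X = (pd_tilde Z chi, pd_tilde W chi)"
      unfolding expansion(3)[symmetric] Let_def
      using potential_in_H1[OF f g] pd_tilde_potential[of f g, OF rot] assms(1) by simp
  qed
qed

end
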